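(* Let $Q\in\mathbb{R}^{d\times d}$ be symmetric positive definite with smallest eigenvalue $\mu>0$ and largest eigenvalue $L$. For $\alpha,\beta\ge0$ let $$A_Q=\begin{bmatrix}(1+\beta)(I_d-\alpha Q)&-\beta(I_d-\alpha Q)\\ I_d&0_d\end{bmatrix},$$ and let $\mathcal{S}=\{(\alpha,\beta):\ \rho(A_Q)<1,\ \alpha\ge0,\ \beta\ge0\}\subset\mathbb{R}^2$. Then the closure of $\mathcal{S}$ in $\mathbb{R}^2$ equals $\mathcal{S}_1\cup\mathcal{S}_2\cup\mathcal{S}_3$, where $$\mathcal{S}_1=\left\{(\alpha,\beta):\ \beta\ge0,\ 0\le\alpha\le\tfrac1L,\ 0\le\beta(1-\alpha\mu)\le1\right\},$$ $$\mathcal{S}_2=\left\{(\alpha,\beta):\ \beta\ge0,\ \tfrac1L<\alpha\le\min\{\tfrac2L,\tfrac1\mu\},\ \alpha L-1\le\tfrac{1}{2\beta+1},\ \beta(1-\alpha\mu)\le1\right\},$$ $$\mathcal{S}_3=\left\{(\alpha,\beta):\ \beta\ge0,\ \tfrac1\mu\le\alpha\le\tfrac2L,\ \alpha L-1\le\tfrac1{2\beta+1}\right\},$$ with the convention that $\mathcal{S}_3$ is empty if $\mu<L/2$.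
   Context: $\rho(M)$ denotes the spectral radius (largest modulus of an eigenvalue) of the matrix $M$. $\mathcal{S}$ is the stability region of Nesterov's accelerated gradient method with stepsize $\alpha$ and momentum parameter $\beta$ applied to a quadratic function with Hessian $Q$. *)

theory Defs
  imports "HOL-Analysis.Analysis" "Jordan_Normal_Form.Spectral_Radius"
begin

definition sym_pos_def :: "nat \<Rightarrow> real mat \<Rightarrow> bool" where
  "sym_pos_def d Q \<longleftrightarrow>
     Q \<in> carrier_mat d d \<and> transpose_mat Q = Q \<and>
     (\<forall>v \<in> carrier_vec d. v \<noteq> 0\<^sub>v d \<longrightarrow> 0 < scalar_prod v (mult_mat_vec Q v))"

definition smallest_eigenvalue :: "real mat \<Rightarrow> real \<Rightarrow> bool" where
  "smallest_eigenvalue Q \<mu> \<longleftrightarrow> eigenvalue Q \<mu> \<and> (\<forall>k. eigenvalue Q k \<longrightarrow> \<mu> \<le> k)"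

definition largest_eigenvalue :: "real mat \<Rightarrow> real \<Rightarrow> bool" where
  "largest_eigenvalue Q L \<longleftrightarrow> eigenvalue Q L \<and> (\<forall>k. eigenvalue Q k \<longrightarrow> k \<le> L)"

definition nesterov_mat :: "nat \<Rightarrow> real mat \<Rightarrow> real \<Rightarrow> real \<Rightarrow> real mat" where
  "nesterov_mat d Q \<alpha> \<beta> =
     four_block_mat
       ((1 + \<beta>) \<cdot>\<^sub>m (1\<^sub>m d - \<alpha> \<cdot>\<^sub>m Q)) ((- \<beta>) \<cdot>\<^sub>m (1\<^sub>m d - \<alpha> \<cdot>\<^sub>m Q))
       (1\<^sub>m d)                      (0\<^sub>m d d)"

(* A real matrix is embedded into the complex matrices before taking its spectral radius,
   since its eigenvalues need not be real. *)
definition stability_region :: "nat \<Rightarrow> real mat \<Rightarrow> (real \<times> real) set" where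
  "stability_region d Q =
     {(\<alpha>, \<beta>). spectral_radius (map_mat complex_of_real (nesterov_mat d Q \<alpha> \<beta>)) < 1
        \<and> 0 \<le> \<alpha> \<and> 0 \<le> \<beta>}"

definition region1 :: "real \<Rightarrow> real \<Rightarrow> (real \<times> real) set" where
  "region1 \<mu> L =
     {(\<alpha>, \<beta>). 0 \<le> \<beta> \<and> 0 \<le> \<alpha> \<and> \<alpha> \<le> 1 / L
        \<and> 0 \<le> \<beta> * (1 - \<alpha> * \<mu>) \<and> \<beta> * (1 - \<alpha> * \<mu>) \<le> 1}"

definition region2 :: "real \<Rightarrow> real \<Rightarrow> (real \<times> real) set" where
  "region2 \<mu> L =
     {(\<alpha>, \<beta>). 0 \<le> \<beta> \<and> 1 / L < \<alpha> \<and> \<alpha> \<le> min (2 / L) (1 / \<mu>)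
        \<and> \<alpha> * L - 1 \<le> 1 / (2 * \<beta> + 1) \<and> \<beta> * (1 - \<alpha> * \<mu>) \<le> 1}"

definition region3 :: "real \<Rightarrow> real \<Rightarrow> (real \<times> real) set" where
  "region3 \<mu> L =
     (if \<mu> < L / 2 then {}
      else {(\<alpha>, \<beta>). 0 \<le> \<beta> \<and> 1 / \<mu> \<le> \<alpha> \<and> \<alpha> \<le> 2 / L
              \<and> \<alpha> * L - 1 \<le> 1 / (2 * \<beta> + 1)})"

end

(* If y is an eigenvector of Q for the eigenvalue k, the eigenvalues of the block matrix belonging
   to y are the roots of z^2 - (1 + \<beta>) c z + \<beta> c with c = 1 - \<alpha> k. By the Schur-Cohn criterion they
   lie in the open unit disc iff c < 1, \<beta> c < 1 and - c (1 + 2 \<beta>) < 1. These conditions are monotone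
   in k, so only k = \<mu> and k = L matter, and the closure of the resulting region is obtained by
   making its inequalities non-strict. *)

theory Submission
  imports Defs
begin

section \<open>Real quadratics with roots in the unit disc\<close>

text \<open>Sufficiency half of the Schur-Cohn criterion. The imaginary part of the equation,
  \<open>y * (2 * x - b) = 0\<close>, separates real roots from conjugate pairs; real roots are
  confined to (-1, 1) by sign considerations, and for a conjugate pair the squared modulus is the
  product \<open>p\<close> of the roots.\<close>

lemma quadratic_root_norm_less_one:
  fixes b p :: real and z :: complex
  assumes root: "z\<^sup>2 - of_real b * z + of_real p = 0"
    and p: "p < 1" and b: "\<bar>b\<bar> < 1 + p"
  shows "norm z < 1"
proof -
  define x y where "x = Re z" and "y = Im z"
  have re: "x\<^sup>2 - y\<^sup>2 - b * x + p = 0" and im: "y * (2 * x - b) = 0"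
    using arg_cong[OF root, of Re] arg_cong[OF root, of Im]
    by (simp_all add: x_def y_def power2_eq_square algebra_simps)
  have nz: "(norm z)\<^sup>2 = x\<^sup>2 + y\<^sup>2" by (simp add: cmod_power2 x_def y_def)
  show ?thesis
  proof (cases "y = 0")
    case True
    have "x < 1"
    proof (rule ccontr)
      assume "\<not> x < 1"
      \<comment> \<open>By the root equation this product equals \<open>b - 1 - p\<close>, which is
        negative. The mirrored product below equals \<open>- b - 1 - p\<close>.\<close>
      then have "0 \<le> (x - 1) * (x + 1 - b)" using p b by (intro mult_nonneg_nonneg) auto
      then show False using re True b by (simp add: power2_eq_square algebra_simps)
    qed
    moreover have "- 1 < x"
    proof (rule ccontr)
      assume "\<not> - 1 < x"
      then have "0 \<le> (- x - 1) * (- x + 1 + b)" using p b by (intro mult_nonneg_nonneg) auto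
      then show False using re True b by (simp add: power2_eq_square algebra_simps)
    qed
    ultimately have "x\<^sup>2 < 1" by (simp add: abs_square_less_1 abs_less_iff)
    then have "(norm z)\<^sup>2 < 1" using nz True by simp
    then show ?thesis by (simp only: abs_square_less_1 abs_norm_cancel)
  next
    case False
    then have "b = 2 * x" using im by simp
    then have "(norm z)\<^sup>2 = p" using re nz by (simp add: power2_eq_square algebra_simps)
    then have "(norm z)\<^sup>2 < 1" using p by simp
    then show ?thesis by (simp only: abs_square_less_1 abs_norm_cancel)
  qed
qed

text \<open>The quadratic formula for an arbitrary square root \<open>w\<close> of the discriminant;
  \<open>- w\<close> gives the other root. A general field lets the same identity serve complex and
  real roots.\<close>

lemma quadratic_at_half_sum:
  fixes b p w :: "'a :: field_char_0"
  assumes "w\<^sup>2 = b\<^sup>2 - 4 * p"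
  shows "((b + w) / 2)\<^sup>2 - b * ((b + w) / 2) + p = 0"
proof -
  have "4 * (((b + w) / 2)\<^sup>2 - b * ((b + w) / 2) + p) = (b + w)\<^sup>2 - 2 * b * (b + w) + 4 * p"
    by (simp add: power_divide algebra_simps)
  also have "\<dots> = w\<^sup>2 - (b\<^sup>2 - 4 * p)" by (simp add: power2_eq_square algebra_simps)
  finally have "4 * (((b + w) / 2)\<^sup>2 - b * ((b + w) / 2) + p) = 0"
    unfolding assms by (simp only: diff_self)
  then show ?thesis by (metis mult_eq_0_iff zero_neq_numeral)
qed

text \<open>Necessity half of Schur-Cohn. The bound on \<open>p\<close> holds because
  \<open>p\<close> is the product of the two complex roots. The bound on \<open>b\<close> is proved
  according to the sign of the discriminant.\<close>

lemma quadratic_roots_norm_less_oneD: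
  fixes b p :: real
  assumes roots: "\<And>z::complex. z\<^sup>2 - of_real b * z + of_real p = 0 \<Longrightarrow> norm z < 1"
  shows "p < 1" and "\<bar>b\<bar> < 1 + p"
proof -
  define s where "s = csqrt (of_real (b\<^sup>2 - 4 * p))"
  have s2: "s\<^sup>2 = (of_real b)\<^sup>2 - 4 * of_real p" by (simp add: s_def)
  have "norm ((of_real b + s) / 2) < 1" "norm ((of_real b + - s) / 2) < 1"
    by (rule roots, rule quadratic_at_half_sum, simp add: s2)+
  moreover have "norm (u * v) < 1" if "norm u < 1" "norm v < 1" for u v :: complex
    using mult_strict_mono'[OF that] by (simp add: norm_mult)
  ultimately have "norm ((of_real b + s) / 2 * ((of_real b + - s) / 2)) < 1"
    by blast
  also have "(u + w) / 2 * ((u + - w) / 2) = (u\<^sup>2 - w\<^sup>2) / 4" for u w :: complex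
    by (simp add: power2_eq_square square_diff_square_factored)
  also have "((of_real b)\<^sup>2 - s\<^sup>2) / 4 = of_real p" by (simp add: s2)
  finally show "p < 1" by simp
  have real_root: "\<bar>(b + t) / 2\<bar> < 1" if "t\<^sup>2 = b\<^sup>2 - 4 * p" for t
  proof -
    let ?x = "(b + t) / 2"
    have "complex_of_real (?x\<^sup>2 - b * ?x + p) = 0"
      using quadratic_at_half_sum[OF that] by (simp only: of_real_0)
    then have "norm (complex_of_real ?x) < 1" by (intro roots) simp
    then show ?thesis by (simp only: norm_of_real)
  qed
  have "\<bar>b\<bar> < 1 + p" if "0 \<le> b\<^sup>2 - 4 * p"
  proof -
    define t where "t = sqrt (b\<^sup>2 - 4 * p)"
    have t: "0 \<le> t" "t\<^sup>2 = b\<^sup>2 - 4 * p" using that by (simp_all add: t_def)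
    have "\<bar>b\<bar> + t < 2" using real_root[of t] real_root[of "- t"] t by auto
    then have "t < 2 - \<bar>b\<bar>" by simp
    \<comment> \<open>After squaring, \<open>b\<^sup>2\<close> cancels and what remains is the claim
      multiplied by 4.\<close>
    then have "t\<^sup>2 < (2 - \<bar>b\<bar>)\<^sup>2" using t by (intro power_strict_mono) auto
    then show ?thesis using t \<open>\<bar>b\<bar> + t < 2\<close> by (auto simp: power2_eq_square algebra_simps)
  qed
  moreover have "\<bar>b\<bar> < 1 + p" if "b\<^sup>2 - 4 * p < 0"
  proof (rule power2_less_imp_less)
    \<comment> \<open>For non-real roots \<open>b\<^sup>2 < 4 * p\<close>, and the
      arithmetic-geometric mean inequality bounds the right side by
      \<open>(1 + p)\<^sup>2\<close>.\<close>
    have "4 * p \<le> (1 + p)\<^sup>2" using zero_le_power2[of "1 - p"]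
      by (simp add: power2_eq_square algebra_simps)
    then show "\<bar>b\<bar>\<^sup>2 < (1 + p)\<^sup>2" using that by simp
    show "0 \<le> 1 + p" using that zero_le_power2[of b] by linarith
  qed
  ultimately show "\<bar>b\<bar> < 1 + p" by fastforce
qed

text \<open>Schur-Cohn with sum \<open>(1 + \<beta>) * c\<close> and product
  \<open>\<beta> * c\<close> of the roots: the upper bound on the sum simplifies to
  \<open>c < 1\<close>, the lower bound to \<open>- c * (1 + 2 * \<beta>) < 1\<close>.\<close>

lemma nesterov_quadratic_stable_iff:
  fixes \<beta> c :: real
  assumes "0 \<le> \<beta>"
  shows "(\<forall>z::complex. z\<^sup>2 - of_real ((1 + \<beta>) * c) * z + of_real (\<beta> * c) = 0 \<longrightarrow> norm z < 1)
     \<longleftrightarrow> c < 1 \<and> \<beta> * c < 1 \<and> - c * (1 + 2 * \<beta>) < 1" (is "?L \<longleftrightarrow> ?R")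
proof
  assume ?L
  then show ?R
    using quadratic_roots_norm_less_oneD[of "(1 + \<beta>) * c" "\<beta> * c"]
    by (auto simp: abs_less_iff algebra_simps)
next
  assume R: ?R
  then have "\<bar>(1 + \<beta>) * c\<bar> < 1 + \<beta> * c" by (auto simp: abs_less_iff algebra_simps)
  then show ?L using R quadratic_root_norm_less_one by blast
qed

section \<open>Eigenvalues of the iteration matrix\<close>

lemma smult_mat_mult_vec:
  fixes A :: "'a :: comm_semiring_0 mat"
  assumes "A \<in> carrier_mat nr nc" "v \<in> carrier_vec nc"
  shows "(k \<cdot>\<^sub>m A) *\<^sub>v v = k \<cdot>\<^sub>v (A *\<^sub>v v)"
  using assms by (intro eq_vecI) auto

text \<open>The lower block row forces every eigenvector to have the form
  \<open>(z \<cdot>\<^sub>v y) @\<^sub>v y\<close>, and the upper row then becomes the stated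
  equation for \<open>y\<close>. No diagonalisation of \<open>M\<close> is involved.\<close>

lemma eigenvalue_momentum_block_iff:
  fixes M :: "'a :: field mat"
  assumes M: "M \<in> carrier_mat d d"
  shows "eigenvalue (four_block_mat ((1 + b) \<cdot>\<^sub>m M) ((- b) \<cdot>\<^sub>m M) (1\<^sub>m d) (0\<^sub>m d d)) z \<longleftrightarrow>
    (\<exists>y \<in> carrier_vec d. y \<noteq> 0\<^sub>v d \<and> ((1 + b) * z - b) \<cdot>\<^sub>v (M *\<^sub>v y) = z\<^sup>2 \<cdot>\<^sub>v y)"
    (is "eigenvalue ?A z \<longleftrightarrow> _")
proof -
  have mult: "?A *\<^sub>v (x @\<^sub>v y) = ((1 + b) \<cdot>\<^sub>v (M *\<^sub>v x) + (- b) \<cdot>\<^sub>v (M *\<^sub>v y)) @\<^sub>v x"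
    if "x \<in> carrier_vec d" "y \<in> carrier_vec d" for x y
    using M that by (subst four_block_mat_mult_vec[of _ d d _ d _ d]) (auto simp: smult_mat_mult_vec)
  have smult: "k \<cdot>\<^sub>v (x @\<^sub>v y) = (k \<cdot>\<^sub>v x) @\<^sub>v (k \<cdot>\<^sub>v y)" for k :: 'a and x y
    by (intro eq_vecI) auto
  have comb: "(1 + b) \<cdot>\<^sub>v (M *\<^sub>v (z \<cdot>\<^sub>v y)) + (- b) \<cdot>\<^sub>v (M *\<^sub>v y)
      = ((1 + b) * z - b) \<cdot>\<^sub>v (M *\<^sub>v y)" if "y \<in> carrier_vec d" for y
    using M that by (subst mult_mat_vec[OF M that], intro eq_vecI) (auto simp: algebra_simps)
  have zero: "0\<^sub>v (d + d) = (0\<^sub>v d :: 'a vec) @\<^sub>v 0\<^sub>v d" by (intro eq_vecI) auto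
  show ?thesis
  proof
    assume "eigenvalue ?A z"
    then obtain w where w: "w \<in> carrier_vec (d + d)" "w \<noteq> 0\<^sub>v (d + d)" "?A *\<^sub>v w = z \<cdot>\<^sub>v w"
      using M by (auto simp: eigenvalue_def eigenvector_def)
    define x y where "x = vec_first w d" and "y = vec_last w d"
    have xy: "x \<in> carrier_vec d" "y \<in> carrier_vec d" "w = x @\<^sub>v y"
      using w by (auto simp: x_def y_def)
    have "(1 + b) \<cdot>\<^sub>v (M *\<^sub>v x) + (- b) \<cdot>\<^sub>v (M *\<^sub>v y) = z \<cdot>\<^sub>v x \<and> x = z \<cdot>\<^sub>v y"
      using w(3) xy M unfolding xy(3) mult[OF xy(1,2)] smult
      by (subst (asm) append_vec_eq[of _ d]) auto
    then have eq: "((1 + b) * z - b) \<cdot>\<^sub>v (M *\<^sub>v y) = z\<^sup>2 \<cdot>\<^sub>v y" and x: "x = z \<cdot>\<^sub>v y"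
      using comb[OF xy(2)] by (auto simp: smult_smult_assoc power2_eq_square)
    have "y \<noteq> 0\<^sub>v d"
    proof
      assume "y = 0\<^sub>v d"
      then have "w = 0\<^sub>v (d + d)" unfolding zero xy(3) x by (auto intro!: eq_vecI)
      then show False using w by simp
    qed
    then show "\<exists>y \<in> carrier_vec d. y \<noteq> 0\<^sub>v d \<and> ((1 + b) * z - b) \<cdot>\<^sub>v (M *\<^sub>v y) = z\<^sup>2 \<cdot>\<^sub>v y"
      using eq xy by auto
  next
    assume "\<exists>y \<in> carrier_vec d. y \<noteq> 0\<^sub>v d \<and> ((1 + b) * z - b) \<cdot>\<^sub>v (M *\<^sub>v y) = z\<^sup>2 \<cdot>\<^sub>v y"
    then obtain y where y: "y \<in> carrier_vec d" "y \<noteq> 0\<^sub>v d"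
      "((1 + b) * z - b) \<cdot>\<^sub>v (M *\<^sub>v y) = z\<^sup>2 \<cdot>\<^sub>v y" by blast
    have "?A *\<^sub>v ((z \<cdot>\<^sub>v y) @\<^sub>v y) = z \<cdot>\<^sub>v ((z \<cdot>\<^sub>v y) @\<^sub>v y)"
      using y comb[OF y(1)] by (simp add: mult smult smult_smult_assoc power2_eq_square)
    moreover have "(z \<cdot>\<^sub>v y) @\<^sub>v y \<noteq> 0\<^sub>v (d + d)"
      unfolding zero using y by (subst append_vec_eq[of _ d]) auto
    ultimately show "eigenvalue ?A z"
      using M y unfolding eigenvalue_def eigenvector_def by (intro exI[of _ "(z \<cdot>\<^sub>v y) @\<^sub>v y"]) auto
  qed
qed

section \<open>Real eigenvalues of symmetric matrices\<close>

lemma scalar_prod_self_pos: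
  fixes v :: "real vec"
  assumes "v \<in> carrier_vec n" "v \<noteq> 0\<^sub>v n"
  shows "0 < scalar_prod v v"
proof -
  obtain i where i: "i < n" "vec_index v i \<noteq> 0"
    using assms by (metis carrier_vecD eq_vecI index_zero_vec)
  have "0 < (\<Sum>j\<in>{0..<n}. vec_index v j * vec_index v j)"
    using i by (intro sum_pos2[of _ i]) (auto simp: zero_less_mult_iff)
  then show ?thesis using assms by (simp add: scalar_prod_def)
qed

lemma scalar_prod_self_nonneg: "0 \<le> scalar_prod v (v :: real vec)"
  by (auto simp: scalar_prod_def intro: sum_nonneg)

text \<open>Splitting \<open>y\<close> into its real part \<open>a\<close> and imaginary part
  \<open>b\<close> turns the complex equation into two real ones. Symmetry of \<open>Q\<close> then
  forces \<open>Im k = 0\<close>, after which whichever of \<open>a\<close>, \<open>b\<close> is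
  nonzero is a real eigenvector.\<close>

lemma eigenvalue_complex_of_real_symmetric:
  fixes Q :: "real mat"
  assumes Q: "Q \<in> carrier_mat d d" and sym: "transpose_mat Q = Q"
    and y: "y \<in> carrier_vec d" "y \<noteq> 0\<^sub>v d"
    and ev: "map_mat complex_of_real Q *\<^sub>v y = k \<cdot>\<^sub>v y"
  obtains r where "k = complex_of_real r" "eigenvalue Q r"
proof -
  define a b where "a = map_vec Re y" and "b = map_vec Im y"
  have ab: "a \<in> carrier_vec d" "b \<in> carrier_vec d" using y by (auto simp: a_def b_def)
  have comp: "(\<Sum>j\<in>{0..<d}. complex_of_real (Q $$ (i,j)) * vec_index y j) = k * vec_index y i"
    if "i < d" for i
    using arg_cong[OF ev, of "\<lambda>v. vec_index v i"] Q y that by (simp add: scalar_prod_def)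
  have Qa: "Q *\<^sub>v a = Re k \<cdot>\<^sub>v a - Im k \<cdot>\<^sub>v b"
  proof (intro eq_vecI)
    fix i assume "i < dim_vec (Re k \<cdot>\<^sub>v a - Im k \<cdot>\<^sub>v b)"
    then have "i < d" using ab by simp
    then show "vec_index (Q *\<^sub>v a) i = vec_index (Re k \<cdot>\<^sub>v a - Im k \<cdot>\<^sub>v b) i"
      using arg_cong[OF comp, of i Re] Q y by (simp add: a_def b_def scalar_prod_def)
  qed (use Q ab in auto)
  have Qb: "Q *\<^sub>v b = Re k \<cdot>\<^sub>v b + Im k \<cdot>\<^sub>v a"
  proof (intro eq_vecI)
    fix i assume "i < dim_vec (Re k \<cdot>\<^sub>v b + Im k \<cdot>\<^sub>v a)"
    then have "i < d" using ab by simp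
    then show "vec_index (Q *\<^sub>v b) i = vec_index (Re k \<cdot>\<^sub>v b + Im k \<cdot>\<^sub>v a) i"
      using arg_cong[OF comp, of i Im] Q y by (simp add: a_def b_def scalar_prod_def)
  qed (use Q ab in auto)
  have ne: "a \<noteq> 0\<^sub>v d \<or> b \<noteq> 0\<^sub>v d"
  proof (rule ccontr)
    assume "\<not> ?thesis"
    then have "a = 0\<^sub>v d" "b = 0\<^sub>v d" by auto
    then have "Re (vec_index y i) = 0 \<and> Im (vec_index y i) = 0" if "i < d" for i
      using that y unfolding a_def b_def
      by (metis carrier_vecD index_map_vec(1) index_zero_vec(1))
    then have "y = 0\<^sub>v d" using y by (intro eq_vecI) (auto simp: complex_eq_iff)
    then show False using y by simp
  qed
  have "scalar_prod b (Q *\<^sub>v a) = scalar_prod (Q *\<^sub>v b) a"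
    using transpose_vec_mult_scalar[OF Q ab] sym by simp
  also have "\<dots> = scalar_prod a (Q *\<^sub>v b)"
    using Q ab by (intro comm_scalar_prod[of _ d]) auto
  \<comment> \<open>Expanding both sides with \<open>Qa\<close> and \<open>Qb\<close>, the
    \<open>Re k\<close> terms cancel because the scalar product commutes.\<close>
  finally have "Im k * (scalar_prod a a + scalar_prod b b) = 0"
    using ab comm_scalar_prod[OF ab] unfolding Qa Qb
    by (simp add: scalar_prod_add_distrib[of _ d] scalar_prod_minus_distrib[of _ d] algebra_simps)
  moreover have "0 < scalar_prod a a + scalar_prod b b"
    using ne scalar_prod_self_pos[OF ab(1)] scalar_prod_self_pos[OF ab(2)]
      scalar_prod_self_nonneg[of a] scalar_prod_self_nonneg[of b] by linarith
  ultimately have k: "Im k = 0" by simp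
  then have "Q *\<^sub>v a = Re k \<cdot>\<^sub>v a" "Q *\<^sub>v b = Re k \<cdot>\<^sub>v b"
    using Qa Qb ab by (auto intro!: eq_vecI)
  then have "eigenvalue Q (Re k)"
    using ne ab Q by (auto simp: eigenvalue_def eigenvector_def)
  moreover have "k = complex_of_real (Re k)" using k by (simp add: complex_eq_iff)
  ultimately show ?thesis using that by blast
qed

section \<open>Eigenvalues of the Nesterov matrix in terms of those of \<open>Q\<close>\<close>

lemma map_mat_nesterov_mat:
  assumes Q: "Q \<in> carrier_mat d d"
  shows "map_mat complex_of_real (nesterov_mat d Q \<alpha> \<beta>) =
    (let M = 1\<^sub>m d - of_real \<alpha> \<cdot>\<^sub>m map_mat complex_of_real Q
     in four_block_mat ((1 + of_real \<beta>) \<cdot>\<^sub>m M) ((- of_real \<beta>) \<cdot>\<^sub>m M) (1\<^sub>m d) (0\<^sub>m d d))"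
  using Q unfolding nesterov_mat_def Let_def
  by (subst map_four_block_mat[of _ d d _ d _ d])
    (auto intro!: cong_four_block_mat eq_matI)

lemma eigenvalue_nesterov_mat_iff:
  fixes Q :: "real mat"
  assumes Q: "Q \<in> carrier_mat d d"
  shows "eigenvalue (map_mat complex_of_real (nesterov_mat d Q \<alpha> \<beta>)) z \<longleftrightarrow>
    (\<exists>y \<in> carrier_vec d. y \<noteq> 0\<^sub>v d \<and>
      ((1 + of_real \<beta>) * z - of_real \<beta>) \<cdot>\<^sub>v (y - of_real \<alpha> \<cdot>\<^sub>v (map_mat complex_of_real Q *\<^sub>v y))
      = z\<^sup>2 \<cdot>\<^sub>v y)"
proof -
  have "(1\<^sub>m d - of_real \<alpha> \<cdot>\<^sub>m map_mat complex_of_real Q) *\<^sub>v y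
    = y - of_real \<alpha> \<cdot>\<^sub>v (map_mat complex_of_real Q *\<^sub>v y)" if "y \<in> carrier_vec d" for y
    using Q that
    by (subst minus_mult_distrib_mat_vec[of _ d d]) (auto simp: smult_mat_mult_vec)
  then show ?thesis
    using Q unfolding map_mat_nesterov_mat[OF Q] Let_def
    by (subst eigenvalue_momentum_block_iff) (auto cong: bex_cong)
qed

text \<open>A real eigenvector of \<open>Q\<close>, embedded into the complex vectors, serves as
  \<open>y\<close> in \<open>eigenvalue_nesterov_mat_iff\<close>: the quadratic is that equation
  restricted to the line spanned by \<open>y\<close>.\<close>

lemma root_imp_eigenvalue_nesterov_mat:
  fixes Q :: "real mat"
  assumes Q: "Q \<in> carrier_mat d d" and ev: "eigenvalue Q k"
    and root: "z\<^sup>2 - of_real ((1 + \<beta>) * (1 - \<alpha> * k)) * z + of_real (\<beta> * (1 - \<alpha> * k)) = 0"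
  shows "eigenvalue (map_mat complex_of_real (nesterov_mat d Q \<alpha> \<beta>)) z"
proof -
  obtain v where v: "v \<in> carrier_vec d" "v \<noteq> 0\<^sub>v d" "Q *\<^sub>v v = k \<cdot>\<^sub>v v"
    using ev Q by (auto simp: eigenvalue_def eigenvector_def)
  define y where "y = map_vec complex_of_real v"
  have y: "y \<in> carrier_vec d" "y \<noteq> 0\<^sub>v d" using v by (auto simp: y_def)
  have Qy: "map_mat complex_of_real Q *\<^sub>v y = of_real k \<cdot>\<^sub>v y"
    unfolding y_def of_real_hom.mult_mat_vec_hom[OF Q v(1), symmetric] v(3)
    by (simp add: of_real_hom.vec_hom_smult)
  have "((1 + of_real \<beta>) * z - of_real \<beta>) * (1 - of_real \<alpha> * of_real k) = z\<^sup>2"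
    using root by (simp add: algebra_simps)
  then have "((1 + of_real \<beta>) * z - of_real \<beta>) * (u - of_real \<alpha> * (of_real k * u)) = z\<^sup>2 * u" for u
    by (metis (no_types, lifting) left_diff_distrib mult.assoc mult_1)
  then have "((1 + of_real \<beta>) * z - of_real \<beta>) \<cdot>\<^sub>v (y - of_real \<alpha> \<cdot>\<^sub>v (of_real k \<cdot>\<^sub>v y)) = z\<^sup>2 \<cdot>\<^sub>v y"
    using y by (intro eq_vecI) auto
  then show ?thesis
    using y Qy unfolding eigenvalue_nesterov_mat_iff[OF Q] by auto
qed

text \<open>The eigenvector equation can be solved for the product of \<open>Q\<close> and
  \<open>y\<close> when \<open>\<alpha>\<close> and the coefficient \<open>e\<close> are nonzero; so
  \<open>y\<close> is an eigenvector of \<open>Q\<close>, with a real eigenvalue by symmetry. The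
  exceptional value \<open>z = 0\<close> lies in the unit disc anyway.\<close>

lemma eigenvalue_nesterov_mat_cases:
  fixes Q :: "real mat"
  assumes Q: "Q \<in> carrier_mat d d" "transpose_mat Q = Q" and \<alpha>: "\<alpha> \<noteq> 0"
    and ev: "eigenvalue (map_mat complex_of_real (nesterov_mat d Q \<alpha> \<beta>)) z"
  obtains "z = 0"
  | k where "eigenvalue Q k"
      "z\<^sup>2 - of_real ((1 + \<beta>) * (1 - \<alpha> * k)) * z + of_real (\<beta> * (1 - \<alpha> * k)) = 0"
proof -
  define e where "e = (1 + of_real \<beta>) * z - of_real \<beta>"
  obtain y where y: "y \<in> carrier_vec d" "y \<noteq> 0\<^sub>v d" and
    eq: "e \<cdot>\<^sub>v (y - of_real \<alpha> \<cdot>\<^sub>v (map_mat complex_of_real Q *\<^sub>v y)) = z\<^sup>2 \<cdot>\<^sub>v y"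
    using ev unfolding eigenvalue_nesterov_mat_iff[OF Q(1)] e_def by blast
  have comp: "e * (vec_index y i - of_real \<alpha> * vec_index (map_mat complex_of_real Q *\<^sub>v y) i)
      = z\<^sup>2 * vec_index y i" if "i < d" for i
    using arg_cong[OF eq, of "\<lambda>v. vec_index v i"] Q y that by simp
  show ?thesis
  proof (cases "e = 0")
    case True
    \<comment> \<open>With \<open>e = 0\<close> the equation reads
      \<open>z\<^sup>2 * vec_index y i = 0\<close>, so a nonzero entry of \<open>y\<close> gives
      \<open>z = 0\<close>.\<close>
    obtain i where "i < d" "vec_index y i \<noteq> 0"
      using y by (metis carrier_vecD eq_vecI index_zero_vec)
    then show ?thesis using comp[of i] True that(1) by simp
  next
    case False
    define c where "c = (1 - z\<^sup>2 / e) / of_real \<alpha>"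
    have "map_mat complex_of_real Q *\<^sub>v y = c \<cdot>\<^sub>v y"
    proof (intro eq_vecI)
      fix i assume "i < dim_vec (c \<cdot>\<^sub>v y)"
      then have "i < d" using y by simp
      then show "vec_index (map_mat complex_of_real Q *\<^sub>v y) i = vec_index (c \<cdot>\<^sub>v y) i"
        using comp[of i] False \<alpha> y Q by (simp add: c_def field_simps del: index_mult_mat_vec)
    qed (use Q y in auto)
    then obtain k where k: "c = of_real k" "eigenvalue Q k"
      using eigenvalue_complex_of_real_symmetric[OF Q y] by blast
    have "z\<^sup>2 = e * (1 - of_real \<alpha> * of_real k)"
      using False \<alpha> unfolding k(1)[symmetric] c_def by simp
    then show ?thesis using that(2)[OF k(2)] by (simp add: e_def algebra_simps)
  qed
qed

text \<open>The condition \<open>1 - \<alpha> * k < 1\<close> turns \<open>0 \<le> \<alpha>\<close>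
  into \<open>0 < \<alpha>\<close>, as eigenvalues are positive. The bound on the product of the
  roots is most restrictive at \<open>\<mu>\<close>, the remaining one at \<open>L\<close>.\<close>

lemma stability_region_eq:
  assumes spd: "sym_pos_def d Q" and sm: "smallest_eigenvalue Q \<mu>"
    and \<mu>: "0 < \<mu>" and la: "largest_eigenvalue Q L"
  shows "stability_region d Q = {(\<alpha>, \<beta>). 0 < \<alpha> \<and> 0 \<le> \<beta> \<and> \<beta> * (1 - \<alpha> * \<mu>) < 1 \<and>
    (\<alpha> * L - 1) * (1 + 2 * \<beta>) < 1}"
proof -
  have Q: "Q \<in> carrier_mat d d" "transpose_mat Q = Q" using spd by (auto simp: sym_pos_def_def)
  have ev: "eigenvalue Q \<mu>" "eigenvalue Q L" and bounds: "\<And>k. eigenvalue Q k \<Longrightarrow> \<mu> \<le> k \<and> k \<le> L"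
    using sm la by (auto simp: smallest_eigenvalue_def largest_eigenvalue_def)
  have d: "0 < d" using eigenvalue_imp_nonzero_dim[OF Q(1) ev(1)] .
  have "spectral_radius (map_mat complex_of_real (nesterov_mat d Q \<alpha> \<beta>)) < 1 \<longleftrightarrow>
      0 < \<alpha> \<and> \<beta> * (1 - \<alpha> * \<mu>) < 1 \<and> (\<alpha> * L - 1) * (1 + 2 * \<beta>) < 1" (is "spectral_radius ?A < 1 \<longleftrightarrow> ?R")
    if nonneg: "0 \<le> \<alpha>" "0 \<le> \<beta>" for \<alpha> \<beta>
  proof -
    have A: "?A \<in> carrier_mat (d + d) (d + d)" using Q by (auto simp: nesterov_mat_def)
    have sr: "spectral_radius ?A < 1 \<longleftrightarrow> (\<forall>z. eigenvalue ?A z \<longrightarrow> norm z < 1)"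
    \<comment> \<open>The spectral radius is attained by some eigenvalue, so the strict bound for
      each eigenvalue passes to the maximum. Positive dimension makes the spectrum nonempty.\<close>
    proof -
      obtain z where "eigenvalue ?A z" "norm z = spectral_radius ?A"
        using spectral_radius_mem_max(1)[OF A] d by (auto simp: spectrum_def)
      moreover have "norm z \<le> spectral_radius ?A" if "eigenvalue ?A z" for z
        using spectral_radius_mem_max(2)[OF A] d that by (auto simp: spectrum_def)
      ultimately show ?thesis by (metis le_less_trans)
    qed
    let ?stable = "\<lambda>k. 1 - \<alpha> * k < 1 \<and> \<beta> * (1 - \<alpha> * k) < 1 \<and> - (1 - \<alpha> * k) * (1 + 2 * \<beta>) < 1"
    note stable = nesterov_quadratic_stable_iff[OF nonneg(2)]
    show ?thesis
    proof
      assume "spectral_radius ?A < 1"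
      then have "?stable k" if "eigenvalue Q k" for k
        using sr root_imp_eigenvalue_nesterov_mat[OF Q(1) that] stable[of "1 - \<alpha> * k"] by blast
      from this[OF ev(1)] this[OF ev(2)] show ?R
        using \<mu> by (auto simp: zero_less_mult_iff)
    next
      assume R: ?R
      have st: "?stable k" if "eigenvalue Q k" for k
      proof -
        have k: "\<mu> \<le> k" "k \<le> L" using bounds that by auto
        have "\<alpha> * \<mu> \<le> \<alpha> * k" "\<alpha> * k \<le> \<alpha> * L" using k nonneg by (auto intro: mult_left_mono)
        then have "\<beta> * (1 - \<alpha> * k) \<le> \<beta> * (1 - \<alpha> * \<mu>)"
          "(\<alpha> * k - 1) * (1 + 2 * \<beta>) \<le> (\<alpha> * L - 1) * (1 + 2 * \<beta>)"
          using nonneg by (auto intro!: mult_left_mono mult_right_mono)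
        then show ?thesis using R k \<mu> by auto
      qed
      have "norm z < 1" if z: "eigenvalue ?A z" for z
      proof (rule eigenvalue_nesterov_mat_cases[OF Q _ z])
        show "\<alpha> \<noteq> 0" using R by simp
      next
        fix k assume "eigenvalue Q k"
          "z\<^sup>2 - of_real ((1 + \<beta>) * (1 - \<alpha> * k)) * z + of_real (\<beta> * (1 - \<alpha> * k)) = 0"
        then show ?thesis using st stable[of "1 - \<alpha> * k"] by blast
      qed simp
      then show "spectral_radius ?A < 1" using sr by blast
    qed
  qed
  then show ?thesis unfolding stability_region_def by auto
qed

section \<open>The closure\<close>

lemma in_closure_of_path:
  fixes f :: "real \<Rightarrow> 'a :: metric_space"
  assumes f: "continuous (at_right 0) f" and mem: "\<And>t. 0 < t \<Longrightarrow> t < 1 \<Longrightarrow> f t \<in> S"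
  shows "f 0 \<in> closure S"
proof (rule Lim_in_closed_set[OF closed_closure])
  show "(f \<longlongrightarrow> f 0) (at_right 0)" using f by (simp add: continuous_within)
  show "\<forall>\<^sub>F t in at_right 0. f t \<in> closure S"
    using mem closure_subset
    by (intro eventually_mono[OF eventually_at_right_real[of 0 1]]) auto
qed simp

text \<open>One inclusion holds because the non-strict system defines a closed set. For the other,
  each of its points is the start of a path that enters the strict region at once.\<close>

lemma closure_stability_inequalities:
  fixes \<mu> L :: real
  assumes \<mu>: "0 < \<mu>" and \<mu>L: "\<mu> \<le> L"
  shows "closure {(\<alpha>, \<beta>). 0 < \<alpha> \<and> 0 \<le> \<beta> \<and> \<beta> * (1 - \<alpha> * \<mu>) < 1 \<and> (\<alpha> * L - 1) * (1 + 2 * \<beta>) < 1}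
    = {(\<alpha>, \<beta>). 0 \<le> \<alpha> \<and> 0 \<le> \<beta> \<and> \<beta> * (1 - \<alpha> * \<mu>) \<le> 1 \<and> (\<alpha> * L - 1) * (1 + 2 * \<beta>) \<le> 1}"
    (is "closure ?S = ?T")
proof
  have "closed ?T"
    unfolding case_prod_beta by (intro closed_Collect_conj closed_Collect_le continuous_intros)
  then show "closure ?S \<subseteq> ?T" by (intro closure_minimal) auto
next
  have L: "0 < L" using assms by simp
  show "?T \<subseteq> closure ?S"
  proof clarify
    fix \<alpha> \<beta> :: real
    assume nonneg: "0 \<le> \<alpha>" "0 \<le> \<beta>" and b: "\<beta> * (1 - \<alpha> * \<mu>) \<le> 1"
      and l: "(\<alpha> * L - 1) * (1 + 2 * \<beta>) \<le> 1"
    show "(\<alpha>, \<beta>) \<in> closure ?S"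
    proof (cases "0 < \<alpha> \<and> 0 < \<beta>")
      case True
      \<comment> \<open>Decreasing the momentum suffices here: it scales
        \<open>\<beta> * (1 - \<alpha> * \<mu>)\<close> by \<open>1 - t\<close>, and it strictly
        lowers the other left side whenever that is positive.\<close>
      have "(\<alpha>, (1 - t) * \<beta>) \<in> ?S" if t: "0 < t" "t < 1" for t
      proof -
        have "(1 - t) * (\<beta> * (1 - \<alpha> * \<mu>)) < 1"
        proof (cases "\<beta> * (1 - \<alpha> * \<mu>) \<le> 0")
          case True
          then show ?thesis using t mult_nonneg_nonpos[of "1 - t" "\<beta> * (1 - \<alpha> * \<mu>)"] by linarith
        next
          case False
          then have "(1 - t) * (\<beta> * (1 - \<alpha> * \<mu>)) < 1 * (\<beta> * (1 - \<alpha> * \<mu>))"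
            using t by (intro mult_strict_right_mono) auto
          then show ?thesis using b by simp
        qed
        moreover have "(\<alpha> * L - 1) * (1 + 2 * ((1 - t) * \<beta>)) < 1"
        proof (cases "\<alpha> * L - 1 \<le> 0")
          case le: True
          have "0 \<le> 1 + 2 * ((1 - t) * \<beta>)" using t nonneg by simp
          then show ?thesis using le mult_nonpos_nonneg[of "\<alpha> * L - 1" "1 + 2 * ((1 - t) * \<beta>)"] by linarith
        next
          case False
          have "(1 - t) * \<beta> < 1 * \<beta>" using t True by (intro mult_strict_right_mono) auto
          then have "(\<alpha> * L - 1) * (1 + 2 * ((1 - t) * \<beta>)) < (\<alpha> * L - 1) * (1 + 2 * \<beta>)"
            using False by (intro mult_strict_left_mono) auto
          then show ?thesis using l by simp
        qed
        ultimately show ?thesis using True t by (simp add: mult.assoc)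
      qed
      then have "(\<alpha>, (1 - 0) * \<beta>) \<in> closure ?S"
        by (intro in_closure_of_path[where f = "\<lambda>t. (\<alpha>, (1 - t) * \<beta>)"] continuous_intros) auto
      then show ?thesis by simp
    next
      case False
      then have zero: "\<alpha> = 0 \<or> \<beta> = 0" using nonneg by auto
      then have l2: "\<alpha> * L \<le> 2" using l by auto
      \<comment> \<open>On the axes the path is the segment towards \<open>(1 / L, 0)\<close>, a
        point of the strict region. It makes a zero stepsize positive and moves the corner
        \<open>\<alpha> * L = 2\<close>, \<open>\<beta> = 0\<close> inwards, which lowering \<beta>
        alone cannot do.\<close>
      have "((1 - t) * \<alpha> + t / L, (1 - t) * \<beta>) \<in> ?S" if t: "0 < t" "t < 1" for t
      proof -
        have pos: "0 < (1 - t) * \<alpha> + t / L" using t L nonneg by (intro add_nonneg_pos) auto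
        have lt: "((1 - t) * \<alpha> + t / L) * L - 1 < 1"
        proof -
          have "((1 - t) * \<alpha> + t / L) * L = (1 - t) * (\<alpha> * L) + t" using L by (simp add: field_simps)
          also have "\<dots> \<le> (1 - t) * 2 + t" using t l2 by (intro add_right_mono mult_left_mono) auto
          finally show ?thesis using t by simp
        qed
        show ?thesis
        proof (cases "\<beta> = 0")
          case True
          then show ?thesis using pos lt by simp
        next
          case False
          then have \<alpha>: "\<alpha> = 0" using zero by simp
          then have "\<beta> \<le> 1" using b by simp
          then have "(1 - t) * \<beta> < 1"
            using t nonneg mult_left_le[of \<beta> "1 - t"] by linarith
          moreover have "(1 - t) * \<beta> * (1 - t / L * \<mu>) \<le> (1 - t) * \<beta>"
            using t nonneg L \<mu> by (intro mult_left_le) auto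
          moreover have "(t / L * L - 1) * (1 + 2 * ((1 - t) * \<beta>)) \<le> 0"
            \<comment> \<open>The first factor is \<open>t - 1\<close>.\<close>
            using t nonneg L by (intro mult_nonpos_nonneg) auto
          ultimately have "(1 - t) * \<beta> * (1 - t / L * \<mu>) < 1"
            "(t / L * L - 1) * (1 + 2 * ((1 - t) * \<beta>)) < 1" by linarith+
          then show ?thesis using \<alpha> pos t nonneg by simp
        qed
      qed
      then have "((1 - 0) * \<alpha> + 0 / L, (1 - 0) * \<beta>) \<in> closure ?S" using L
        by (intro in_closure_of_path[where f = "\<lambda>t. ((1 - t) * \<alpha> + t / L, (1 - t) * \<beta>)"]
            continuous_intros) auto
      then show ?thesis by simp
    qed
  qed
qed

text \<open>The regions cut one system of inequalities along \<open>\<alpha> * L = 1\<close> and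
  \<open>\<alpha> * \<mu> = 1\<close>; on each piece the inequalities left out of its definition are
  automatic, and the extra bounds written there follow from the system.\<close>

lemma regions_Un_eq:
  fixes \<mu> L :: real
  assumes \<mu>: "0 < \<mu>" and \<mu>L: "\<mu> \<le> L"
  shows "region1 \<mu> L \<union> region2 \<mu> L \<union> region3 \<mu> L =
    {(\<alpha>, \<beta>). 0 \<le> \<alpha> \<and> 0 \<le> \<beta> \<and> \<beta> * (1 - \<alpha> * \<mu>) \<le> 1 \<and> (\<alpha> * L - 1) * (1 + 2 * \<beta>) \<le> 1}"
proof -
  have L: "0 < L" using assms by simp
  have "(\<alpha>, \<beta>) \<in> region1 \<mu> L \<union> region2 \<mu> L \<union> region3 \<mu> L \<longleftrightarrow>
     0 \<le> \<alpha> \<and> 0 \<le> \<beta> \<and> \<beta> * (1 - \<alpha> * \<mu>) \<le> 1 \<and> (\<alpha> * L - 1) * (1 + 2 * \<beta>) \<le> 1" for \<alpha> \<beta>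
  proof (cases "0 \<le> \<beta> \<and> 0 \<le> \<alpha>")
    case False
    have "\<not> 1 / L < \<alpha>" "\<not> 1 / \<mu> \<le> \<alpha>" if "\<not> 0 \<le> \<alpha>"
      using that L \<mu> by (smt (verit) zero_less_divide_iff)+
    then show ?thesis using False by (auto simp: region1_def region2_def region3_def)
  next
    case True
    then have nonneg: "0 \<le> \<beta>" "0 \<le> \<alpha>" by auto
    have frac: "\<alpha> * L - 1 \<le> 1 / (2 * \<beta> + 1) \<longleftrightarrow> (\<alpha> * L - 1) * (1 + 2 * \<beta>) \<le> 1"
      using nonneg by (simp add: pos_le_divide_eq add.commute)
    have cmp: "\<alpha> \<le> 1 / L \<longleftrightarrow> \<alpha> * L \<le> 1" "1 / L < \<alpha> \<longleftrightarrow> 1 < \<alpha> * L" "\<alpha> \<le> 2 / L \<longleftrightarrow> \<alpha> * L \<le> 2"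
      "\<alpha> \<le> 1 / \<mu> \<longleftrightarrow> \<alpha> * \<mu> \<le> 1" "1 / \<mu> \<le> \<alpha> \<longleftrightarrow> 1 \<le> \<alpha> * \<mu>"
      using L \<mu> by (simp_all add: field_simps)
    have m: "\<alpha> * \<mu> \<le> \<alpha> * L" using nonneg \<mu>L by (intro mult_left_mono) auto
    \<comment> \<open>This recovers the bound \<open>\<alpha> \<le> 2 / L\<close> of the second and
      third regions: as \<open>1 + 2 * \<beta>\<close> is at least 1, a value
      \<open>\<alpha> * L - 1 > 1\<close> would violate the inequality.\<close>
    have le2: "\<alpha> * L \<le> 2" if "(\<alpha> * L - 1) * (1 + 2 * \<beta>) \<le> 1"
    proof (rule ccontr)
      assume *: "\<not> \<alpha> * L \<le> 2"
      then have "(\<alpha> * L - 1) * 1 \<le> (\<alpha> * L - 1) * (1 + 2 * \<beta>)"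
        using nonneg by (intro mult_left_mono) auto
      from order_trans[OF this that] show False using * by simp
    qed
    have r1: "(\<alpha> * L - 1) * (1 + 2 * \<beta>) \<le> 1" if "\<alpha> * L \<le> 1"
      using mult_nonpos_nonneg[of "\<alpha> * L - 1" "1 + 2 * \<beta>"] that nonneg by simp
    have pos: "0 \<le> \<beta> * (1 - \<alpha> * \<mu>)" if "\<alpha> * \<mu> \<le> 1" using that nonneg by simp
    have neg: "\<beta> * (1 - \<alpha> * \<mu>) \<le> 1" if "1 \<le> \<alpha> * \<mu>"
      using mult_nonneg_nonpos[of \<beta> "1 - \<alpha> * \<mu>"] that nonneg by simp
    \<comment> \<open>This justifies the convention for the third region: if
      \<open>\<mu> < L / 2\<close>, no stepsize up to \<open>2 / L\<close> reaches
      \<open>1 / \<mu>\<close>, so setting the region empty loses no points.\<close>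
    have empty: "\<alpha> * \<mu> < 1" if "\<mu> < L / 2" "\<alpha> * L \<le> 2"
    proof (cases "\<alpha> = 0")
      case False
      then have "\<alpha> * \<mu> < \<alpha> * (L / 2)" using that nonneg by (intro mult_strict_left_mono) auto
      then show ?thesis using that by simp
    qed simp
    show ?thesis
    proof (cases "\<alpha> * L \<le> 1")
      case True
      then show ?thesis using nonneg m r1 pos neg
        by (auto simp: region1_def region2_def region3_def frac cmp)
    next
      case False
      then show ?thesis using nonneg m le2 neg empty
        by (cases "\<alpha> * \<mu> \<le> 1") (auto simp: region1_def region2_def region3_def frac cmp)
    qed
  qed
  then show ?thesis by auto
qed

theorem proposition3p6:
  fixes d :: nat and Q :: "real mat" and \<mu> L :: real
  assumes "sym_pos_def d Q"
    and "smallest_eigenvalue Q \<mu>"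
    and "0 < \<mu>"
    and "largest_eigenvalue Q L"
  shows "closure (stability_region d Q) = region1 \<mu> L \<union> region2 \<mu> L \<union> region3 \<mu> L"
proof -
  have "\<mu> \<le> L" using assms by (auto simp: smallest_eigenvalue_def largest_eigenvalue_def)
  then show ?thesis
    using assms by (simp add: stability_region_eq closure_stability_inequalities regions_Un_eq)
qed

end
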